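(* Let $A\in\mathbb{R}^{m\times n}$ be semi-monotone, let $A=P_1-R_1+S_1$ be a double proper weak regular splitting and $A=P_2-R_2+S_2$ a double proper regular splitting of $A$. Suppose $N(S_2)\supseteq N(P_2)$, $R(S_2)\subseteq R(P_2)$, $1\notin\sigma(S_2P_1^{\dagger})$ and $\widehat{A}^{\dagger}\geq 0$, where $\widehat{A}=(I-S_2P_1^{\dagger})A$. If $P_1^{\dagger}\leq P_2^{\dagger}$ and $P_1^{\dagger}R_1\leq P_2^{\dagger}R_2$, then $\rho(W_{12})\leq\rho(T_1)<1$, where $$W_{12}=\begin{pmatrix} P_2^{\dagger}R_2-P_2^{\dagger}S_2P_1^{\dagger}R_1 & P_2^{\dagger}S_2P_1^{\dagger}S_1\\ I & 0\end{pmatrix},\qquad T_1=\begin{pmatrix} P_1^{\dagger}R_1 & -P_1^{\dagger}S_1\\ I&0\end{pmatrix}.$$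
   Context: For $M\in\mathbb{R}^{m\times n}$, $M^{\dagger}$ is its Moore–Penrose inverse, $R(M)$, $N(M)$ its range and null space; inequalities are entrywise; $\rho$ is the spectral radius, $\sigma$ the spectrum. $A$ is semi-monotone if $A^{\dagger}\geq 0$. A double splitting $A=P-R+S$ is a double proper splitting if $R(P)=R(A)$ and $N(P)=N(A)$; it is double proper regular if moreover $P^{\dagger}\geq0$, $R\geq0$, $S\leq0$; double proper weak regular if moreover $P^{\dagger}\geq 0$, $P^{\dagger}R\geq 0$, $P^{\dagger}S\leq 0$. *)

theory Defs
  imports "Jordan_Normal_Form.Spectral_Radius" "Jordan_Normal_Form.Matrix_Kernel"
begin

definition mp_inverse :: "real mat \<Rightarrow> real mat" where
  "mp_inverse A = (THE X. X \<in> carrier_mat (dim_col A) (dim_row A) \<and>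
      A * X * A = A \<and> X * A * X = X \<and>
      transpose_mat (A * X) = A * X \<and> transpose_mat (X * A) = X * A)"

definition mat_range :: "real mat \<Rightarrow> real vec set" where
  "mat_range A = {A *\<^sub>v x | x. x \<in> carrier_vec (dim_col A)}"

definition mat_null :: "real mat \<Rightarrow> real vec set" where
  "mat_null A = mat_kernel A"

definition semi_monotone :: "real mat \<Rightarrow> bool" where
  "semi_monotone A \<longleftrightarrow> mp_inverse A \<ge> 0\<^sub>m (dim_col A) (dim_row A)"

definition double_proper_splitting :: "real mat \<Rightarrow> real mat \<Rightarrow> real mat \<Rightarrow> real mat \<Rightarrow> bool" where
  "double_proper_splitting A P R S \<longleftrightarrow>
     P \<in> carrier_mat (dim_row A) (dim_col A) \<and> R \<in> carrier_mat (dim_row A) (dim_col A) \<and>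
     S \<in> carrier_mat (dim_row A) (dim_col A) \<and>
     A = P - R + S \<and> mat_range P = mat_range A \<and> mat_null P = mat_null A"

definition double_proper_regular :: "real mat \<Rightarrow> real mat \<Rightarrow> real mat \<Rightarrow> real mat \<Rightarrow> bool" where
  "double_proper_regular A P R S \<longleftrightarrow> double_proper_splitting A P R S \<and>
     mp_inverse P \<ge> 0\<^sub>m (dim_col A) (dim_row A) \<and>
     R \<ge> 0\<^sub>m (dim_row A) (dim_col A) \<and> S \<le> 0\<^sub>m (dim_row A) (dim_col A)"

definition double_proper_weak_regular :: "real mat \<Rightarrow> real mat \<Rightarrow> real mat \<Rightarrow> real mat \<Rightarrow> bool" where
  "double_proper_weak_regular A P R S \<longleftrightarrow> double_proper_splitting A P R S \<and>
     mp_inverse P \<ge> 0\<^sub>m (dim_col A) (dim_row A) \<and>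
     mp_inverse P * R \<ge> 0\<^sub>m (dim_col A) (dim_col A) \<and>
     mp_inverse P * S \<le> 0\<^sub>m (dim_col A) (dim_col A)"

definition rspectrum :: "real mat \<Rightarrow> complex set" where
  "rspectrum A = spectrum (map_mat complex_of_real A)"

definition rspectral_radius :: "real mat \<Rightarrow> real" where
  "rspectral_radius A = spectral_radius (map_mat complex_of_real A)"

end

theory Submission
  imports Defs
begin

text \<open>
  Write \<open>D\<close>, \<open>X\<^sub>1\<close>, \<open>X\<^sub>2\<close> for the Moore-Penrose inverses of \<open>A\<close>, \<open>P\<^sub>1\<close>, \<open>P\<^sub>2\<close>, and let
  \<open>B = X\<^sub>1 R\<^sub>1\<close>, \<open>C = - X\<^sub>1 S\<^sub>1\<close>, \<open>U = - S\<^sub>2\<close>. Since the splittings are proper, \<open>A D = P\<^sub>i X\<^sub>i\<close> and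
  \<open>D A = X\<^sub>i P\<^sub>i\<close>, whence \<open>D = X\<^sub>1 + (B + C) D\<close> and \<open>D = X\<^sub>2 + (X\<^sub>2 R\<^sub>2 + X\<^sub>2 U) D\<close>. Instead of Perron
  vectors only subinvariant ones are needed: a nonnegative \<open>M\<close> has a nonzero \<open>x \<ge> 0\<close> with
  \<open>M x \<ge> \<rho>(M) x\<close>, and \<open>M x \<ge> r x\<close> implies \<open>r \<le> \<rho>(M)\<close>; likewise for rows.

  If \<open>\<rho>(T\<^sub>1) \<ge> 1\<close>, a subinvariant row gives \<open>y \<le> y (B + C)\<close>; multiplying by \<open>D \<ge> 0\<close> yields
  \<open>y X\<^sub>1 \<le> 0\<close>, so \<open>y = 0\<close>. The same argument shows \<open>\<mu> = \<rho>(W\<^sub>1\<^sub>2) < 1\<close>. For \<open>\<mu> > 0\<close> a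
  subinvariant row \<open>y\<close> of \<open>W\<^sub>1\<^sub>2\<close>, multiplied by \<open>D\<close>, turns into \<open>z J \<ge> \<mu>\<^sup>2 z\<close> with \<open>z = y X\<^sub>2\<close> and
  \<open>J = ((\<mu> - \<mu>\<^sup>2) R\<^sub>2 + (1 - \<mu>\<^sup>2) U) D \<ge> 0\<close>. Hence \<open>\<rho>(J) \<ge> \<mu>\<^sup>2\<close>, and there is a column \<open>h \<ge> 0\<close> in
  the range of \<open>J\<close> with \<open>J h \<ge> \<mu>\<^sup>2 h\<close>. For \<open>v = D h \<ge> 0\<close> this means \<open>A v = h \<ge> 0\<close>, and
  this sign information together with \<open>X\<^sub>1 \<le> X\<^sub>2\<close> and \<open>B \<le> X\<^sub>2 R\<^sub>2\<close> gives
  \<open>\<mu>\<^sup>2 v \<le> \<mu> B v + C v\<close>, that is, \<open>\<mu> \<le> \<rho>(T\<^sub>1)\<close>.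
\<close>

declare assoc_mult_mat [simp del] \<comment> \<open>loops with \<open>mult_assoc_dim[symmetric]\<close>\<close>

section \<open>Matrix algebra under dimension equations\<close>

lemma mult_assoc_dim:
  "dim_col A = dim_row B \<Longrightarrow> dim_col B = dim_row C \<Longrightarrow> A * B * C = A * (B * C)"
  for A :: "'a :: semiring_0 mat"
  by (rule assoc_mult_mat[of _ "dim_row A" "dim_col A" _ "dim_col B" _ "dim_col C"]) auto

lemma add_mult_dim:
  "dim_row A = dim_row B \<Longrightarrow> dim_col A = dim_col B \<Longrightarrow> dim_col B = dim_row C \<Longrightarrow> (A + B) * C = A * C + B * C"
  for A :: "'a :: semiring_0 mat"
  by (rule add_mult_distrib_mat[of _ "dim_row A" "dim_col A" _ _ "dim_col C"]) auto

lemma mult_add_dim: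
  "dim_row B = dim_row C \<Longrightarrow> dim_col B = dim_col C \<Longrightarrow> dim_col A = dim_row C \<Longrightarrow> A * (B + C) = A * B + A * C"
  for A :: "'a :: semiring_0 mat"
  by (rule mult_add_distrib_mat[of _ "dim_row A" "dim_col A" _ "dim_col C"]) auto

lemma minus_mult_dim:
  "dim_row A = dim_row B \<Longrightarrow> dim_col A = dim_col B \<Longrightarrow> dim_col B = dim_row C \<Longrightarrow> (A - B) * C = A * C - B * C"
  for A :: "'a :: ring mat"
  by (rule minus_mult_distrib_mat[of _ "dim_row A" "dim_col A" _ _ "dim_col C"]) auto

lemma mult_minus_dim:
  "dim_row B = dim_row C \<Longrightarrow> dim_col B = dim_col C \<Longrightarrow> dim_col A = dim_row C \<Longrightarrow> A * (B - C) = A * B - A * C"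
  for A :: "'a :: ring mat"
  by (rule mult_minus_distrib_mat[of _ "dim_row A" "dim_col A" _ "dim_col C"]) auto

lemma smult_mult_dim: "dim_col A = dim_row B \<Longrightarrow> (k \<cdot>\<^sub>m A) * B = k \<cdot>\<^sub>m (A * B)"
  for A :: "'a :: comm_semiring_0 mat"
  by (rule mult_smult_assoc_mat[of _ "dim_row A" "dim_col A" _ "dim_col B"]) auto

lemma mult_smult_dim: "dim_col A = dim_row B \<Longrightarrow> A * (k \<cdot>\<^sub>m B) = k \<cdot>\<^sub>m (A * B)"
  for A :: "'a :: comm_semiring_0 mat"
  by (rule mult_smult_distrib[of _ "dim_row A" "dim_col A" _ "dim_col B"]) auto

lemma transpose_mult_dim: "dim_col A = dim_row B \<Longrightarrow> transpose_mat (A * B) = transpose_mat B * transpose_mat A"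
  for A :: "'a :: comm_semiring_0 mat"
  by (rule transpose_mult[of _ "dim_row A" "dim_col A" _ "dim_col B"]) auto

text \<open>Premises about \<open>dim_row\<close> and \<open>dim_col\<close>, unlike carrier
  premises with free dimensions, can be discharged by the simplifier. Together the rules expand a
  term into a sum of right-nested products.\<close>

lemmas mat_dim_simps = mult_assoc_dim add_mult_dim mult_add_dim minus_mult_dim mult_minus_dim
  smult_mult_dim mult_smult_dim

lemma mat_minus_eq_0D:
  fixes X Y :: "'a :: ab_group_add mat"
  assumes "X - Y = 0\<^sub>m r c" and "dim_row X = r" "dim_row Y = r" "dim_col X = c" "dim_col Y = c"
  shows "X = Y"
proof (rule eq_matI)
  fix i j assume ij: "i < dim_row Y" "j < dim_col Y"
  from arg_cong[OF assms(1), of "\<lambda>M. M $$ (i,j)"] ij assms(2-) show "X $$ (i,j) = Y $$ (i,j)" by simp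
qed (use assms in auto)

lemma vec_of_index: "dim_vec v = n \<Longrightarrow> vec n (($) v) = v"
  by auto

section \<open>The Moore-Penrose inverse\<close>

definition is_mp_inverse :: "real mat \<Rightarrow> real mat \<Rightarrow> bool" where
  "is_mp_inverse A X \<longleftrightarrow> X \<in> carrier_mat (dim_col A) (dim_row A) \<and>
      A * X * A = A \<and> X * A * X = X \<and>
      transpose_mat (A * X) = A * X \<and> transpose_mat (X * A) = X * A"

text \<open>Diagonal entry \<open>j\<close> of the Gram matrix is the sum of squares of column
  \<open>j\<close>.\<close>

lemma gram_eq_0D:
  fixes M :: "real mat"
  assumes M: "M \<in> carrier_mat m n" and Z: "transpose_mat M * M = 0\<^sub>m n n"
  shows "M = 0\<^sub>m m n"
proof (rule eq_matI)
  fix i j assume ij: "i < dim_row (0\<^sub>m m n :: real mat)" "j < dim_col (0\<^sub>m m n :: real mat)"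
  have "(\<Sum>l<m. (M $$ (l,j))\<^sup>2) = (transpose_mat M * M) $$ (j,j)"
    using M ij by (auto simp: scalar_prod_def power2_eq_square lessThan_atLeast0)
  then have "(\<Sum>l<m. (M $$ (l,j))\<^sup>2) = 0" using Z ij by simp
  then have "\<forall>l<m. (M $$ (l,j))\<^sup>2 = 0" by (subst (asm) sum_nonneg_eq_0_iff) auto
  then show "M $$ (i,j) = 0\<^sub>m m n $$ (i,j)" using ij by simp
qed (use M in auto)

text \<open>The columns of \<open>A\<close> are treated one after the other: if \<open>A G\<close> fixes the first \<open>k\<close> columns but
  not column \<open>a\<close>, a rank-one correction \<open>(e\<^sub>k - G a) b\<^sup>T\<close> with \<open>b\<close> orthogonal to the first
  \<open>k\<close> columns makes it fix \<open>a\<close> as well.\<close>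

lemma inner_inverse_columns:
  fixes A :: "real mat"
  assumes A: "A \<in> carrier_mat m n" and "k \<le> n"
  shows "\<exists>G \<in> carrier_mat n m. \<forall>j<k. A * (G * mat_of_cols m [col A j]) = mat_of_cols m [col A j]"
  using \<open>k \<le> n\<close>
proof (induction k)
  case 0
  then show ?case by (intro bexI[of _ "0\<^sub>m n m"]) auto
next
  case (Suc k)
  let ?c = "\<lambda>j. mat_of_cols m [col A j]"
  from Suc obtain G where G: "G \<in> carrier_mat n m"
    and fix_G: "\<And>j. j < k \<Longrightarrow> A * (G * ?c j) = ?c j" by auto
  \<comment> \<open>\<open>E\<close> is the unit column with \<open>A * E = a\<close>, and
    \<open>c\<close> is the defect of \<open>A * G\<close> on \<open>a\<close>.\<close>
  define E where "E = mat_of_cols n [unit_vec n k :: real vec]"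
  define a where "a = ?c k"
  define c where "c = a - A * (G * a)"
  have dims [simp]: "dim_row A = m" "dim_col A = n" "dim_row G = n" "dim_col G = m" "dim_row E = n"
    "dim_col E = 1" "dim_row a = m" "dim_col a = 1" "dim_row c = m" "dim_col c = 1"
    using A G by (auto simp: E_def a_def c_def)
  have AE: "A * E = a"
  proof (rule eq_matI)
    show "(A * E) $$ (i,j) = a $$ (i,j)" if "i < dim_row a" "j < dim_col a" for i j
      using that Suc.prems by (simp add: E_def a_def mat_of_cols_def vec_of_index)
  qed auto
  show ?case
  proof (cases "c = 0\<^sub>m m 1")
    case True
    then have "a = A * (G * a)" unfolding c_def by (rule mat_minus_eq_0D) auto
    then have "A * (G * a) = a" by simp
    then show ?thesis using G fix_G by (intro bexI[of _ G]) (auto simp: a_def less_Suc_eq)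
  next
    case False
    define s where "s = (transpose_mat c * c) $$ (0,0)"
    have s: "transpose_mat c * c = s \<cdot>\<^sub>m 1\<^sub>m 1" 
      by (intro eq_matI) (auto simp: s_def simp del: index_mult_mat(1))
    have "s \<noteq> 0"
    proof
      assume "s = 0"
      then have "transpose_mat c * c = 0\<^sub>m 1 1" unfolding s by (intro eq_matI) auto
      then show False using gram_eq_0D[of c m 1] False by (metis carrier_matI dims(9,10))
    qed
    \<comment> \<open>Applied to \<open>x\<close>, this row gives
      \<open>c^T (x - A G x) / s\<close>. It vanishes on columns that \<open>A * G\<close> fixes,
      and it is 1 on \<open>a\<close>, because there the difference is \<open>c\<close> and
      \<open>s = c^T c\<close>.\<close>
    define b where "b = (1 / s) \<cdot>\<^sub>m (transpose_mat c - transpose_mat c * (A * G))"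
    define H where "H = G + (E - G * a) * b"
    have dims' [simp]: "dim_row b = 1" "dim_col b = m" "dim_row H = n" "dim_col H = m"
      by (auto simp: b_def H_def)
    have AE': "A * (E * y) = a * y" if "dim_row y = 1" for y
      using that by (simp add: AE mult_assoc_dim[symmetric])
    \<comment> \<open>The correction contributes \<open>c\<close>, since
      \<open>A * (E - G * a) = a - A * (G * a)\<close>.\<close>
    have AH: "A * (H * x) = A * (G * x) + c * (b * x)" if [simp]: "dim_row x = m" for x
      unfolding H_def c_def by (simp add: mat_dim_simps AE')
    have b_x: "b * x = (1 / s) \<cdot>\<^sub>m (transpose_mat c * (x - A * (G * x)))"
      if [simp]: "dim_row x = m" for x
      unfolding b_def by (simp add: mat_dim_simps)
    have "A * (H * ?c j) = ?c j" if j: "j < Suc k" for j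
    proof (cases "j = k")
      case True
      have "b * a = 1\<^sub>m 1"
        using \<open>s \<noteq> 0\<close> by (subst b_x) (simp_all add: c_def[symmetric] s, intro eq_matI, auto)
      then have "A * (H * a) = A * (G * a) + c" by (simp add: AH)
      also have "\<dots> = a" unfolding c_def by (intro eq_matI) (auto simp del: index_mult_mat(1))
      finally show ?thesis using True by (simp add: a_def)
    next
      case False
      with j have "j < k" by simp
      from fix_G[OF this] have *: "A * (G * ?c j) = ?c j" .
      have "?c j - ?c j = 0\<^sub>m m 1" by (intro eq_matI) auto
      then have "b * ?c j = 0\<^sub>m 1 1" by (subst b_x) (simp_all add: *)
      then show ?thesis by (subst AH) (simp_all add: *, intro eq_matI, auto)
    qed
    then show ?thesis by (intro bexI[of _ H]) auto
  qed
qed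

lemma inner_inverse_exists:
  fixes A :: "real mat"
  assumes A: "A \<in> carrier_mat m n"
  shows "\<exists>G \<in> carrier_mat n m. A * G * A = A"
proof -
  from inner_inverse_columns[OF A order_refl] obtain G where G: "G \<in> carrier_mat n m"
    and fix_G: "\<And>j. j < n \<Longrightarrow> A * (G * mat_of_cols m [col A j]) = mat_of_cols m [col A j]" by auto
  have [simp]: "dim_row A = m" "dim_col A = n" "dim_row G = n" "dim_col G = m" using A G by auto
  have "A * G * A = A"
  proof (rule eq_matI)
    fix i j assume ij: "i < dim_row A" "j < dim_col A"
    have "(A * G) * mat_of_cols m [col A j] = mat_of_cols m [col A j]"
      using fix_G[of j] ij by (simp add: mat_dim_simps)
    from arg_cong[OF this, of "\<lambda>M. M $$ (i,0)"] ij show "(A * G * A) $$ (i,j) = A $$ (i,j)"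
      by (simp add: mat_of_cols_def vec_of_index)
  qed auto
  with G show ?thesis by auto
qed

text \<open>With \<open>G\<close> an inner inverse of the Gram matrix \<open>A^T A\<close>, the
  witness is \<open>G A^T\<close>, as in the normal equations.\<close>

lemma least_squares_inverse_exists:
  fixes A :: "real mat"
  assumes A: "A \<in> carrier_mat m n"
  shows "\<exists>X \<in> carrier_mat n m. A * X * A = A \<and> transpose_mat (A * X) = A * X"
proof -
  let ?T = "transpose_mat A"
  from A have "?T * A \<in> carrier_mat n n" by auto
  from inner_inverse_exists[OF this] obtain G where G: "G \<in> carrier_mat n n"
    and GG: "?T * A * G * (?T * A) = ?T * A" by auto
  have [simp]: "dim_row A = m" "dim_col A = n" "dim_row G = n" "dim_col G = n" using A G by auto
  define E where "E = A * G * ?T"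
  have [simp]: "dim_row E = m" "dim_col E = m" by (auto simp: E_def)
  have EA: "E * A = A"
  proof -
    have TM: "?T * (E * A - A) = 0\<^sub>m n n"
      using GG by (intro eq_matI) (simp_all add: E_def mat_dim_simps del: index_mult_mat(1))
    \<comment> \<open>The difference has columns in the range of \<open>A\<close> and is annihilated
      by \<open>A^T\<close>, so its own Gram matrix vanishes.\<close>
    have "E * A - A = A * (G * (?T * A) - 1\<^sub>m n)" by (simp add: E_def mat_dim_simps)
    then have "transpose_mat (E * A - A) = transpose_mat (G * (?T * A) - 1\<^sub>m n) * ?T"
      by (simp add: transpose_mult_dim)
    then have "transpose_mat (E * A - A) * (E * A - A) = 0\<^sub>m n n"
      using TM by (simp add: mult_assoc_dim)
    then have "E * A - A = 0\<^sub>m m n" by (rule gram_eq_0D[rotated]) auto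
    then show ?thesis by (rule mat_minus_eq_0D) auto
  qed
  have "transpose_mat E = A * (transpose_mat G * ?T)"
    by (simp add: E_def transpose_mult_dim mult_assoc_dim)
  \<comment> \<open>\<open>E\<close> fixes \<open>A\<close> and hence its own transpose, which has
    \<open>A\<close> as left factor. Since \<open>E * transpose_mat E\<close> is symmetric, so is
    \<open>E\<close>.\<close>
  then have *: "E * transpose_mat E = transpose_mat E"
    using EA by (simp add: mult_assoc_dim[symmetric])
  then have "transpose_mat (E * transpose_mat E) = E" by simp
  moreover have "transpose_mat (E * transpose_mat E) = E * transpose_mat E"
    by (simp add: transpose_mult_dim)
  ultimately have "transpose_mat E = E" using * by (metis (no_types))
  then show ?thesis using G A EA
    by (intro bexI[of _ "G * ?T"]) (auto simp: E_def mult_assoc_dim)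
qed

text \<open>Take inner inverses \<open>X\<close> with \<open>A * X\<close> symmetric and
  \<open>Y\<close> with \<open>Y * A\<close> symmetric, the latter by transposition. Their
  combination \<open>Y * A * X\<close> inherits both projectors.\<close>

lemma mp_inverse_exists: "\<exists>X. is_mp_inverse A X"
proof -
  let ?m = "dim_row A" and ?n = "dim_col A"
  from least_squares_inverse_exists[of A ?m ?n] obtain X where X: "X \<in> carrier_mat ?n ?m"
    and X1: "A * X * A = A" and X2: "transpose_mat (A * X) = A * X" by auto
  from least_squares_inverse_exists[of "transpose_mat A" ?n ?m] obtain Y' where
    Y': "Y' \<in> carrier_mat ?m ?n" "transpose_mat A * Y' * transpose_mat A = transpose_mat A"
    "transpose_mat (transpose_mat A * Y') = transpose_mat A * Y'" by auto
  define Y where "Y = transpose_mat Y'"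
  have Y: "Y \<in> carrier_mat ?n ?m" and [simp]: "dim_row Y' = ?m" "dim_col Y' = ?n" "dim_row X = ?n" "dim_col X = ?m"
    "dim_row Y = ?n" "dim_col Y = ?m"
    using Y' X by (auto simp: Y_def)
  have Y1: "A * Y * A = A"
    using arg_cong[OF Y'(2), of transpose_mat] by (simp add: Y_def transpose_mult_dim mult_assoc_dim)
  have Y2: "transpose_mat (Y * A) = Y * A"
    using Y'(3) by (simp add: Y_def transpose_mult_dim)
  define Z where "Z = Y * A * X"
  have AZ: "A * Z = A * X" and ZA: "Z * A = Y * A"
    using X1 Y1 by (simp_all add: Z_def mult_assoc_dim) (simp_all add: mult_assoc_dim[symmetric])
  have "Z * A * Z = Z" unfolding ZA using Y1 by (simp add: Z_def mult_assoc_dim) (simp add: mult_assoc_dim[symmetric])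
  then have "is_mp_inverse A Z" unfolding is_mp_inverse_def
    using AZ ZA X1 X2 Y2 by (auto simp: Z_def)
  then show ?thesis ..
qed

text \<open>Symmetry lets the projectors absorb each other, giving \<open>A * X = A * Y\<close> and
  \<open>X * A = Y * A\<close>. Then \<open>X = X A X = X A Y = Y A Y = Y\<close>.\<close>

lemma is_mp_inverse_unique:
  assumes X: "is_mp_inverse A X" and Y: "is_mp_inverse A Y"
  shows "X = Y"
proof -
  have [simp]: "dim_row X = dim_col A" "dim_col X = dim_row A" "dim_row Y = dim_col A" "dim_col Y = dim_row A"
    using assms by (auto simp: is_mp_inverse_def)
  note X = X[unfolded is_mp_inverse_def] and Y = Y[unfolded is_mp_inverse_def]
  have "A * X = transpose_mat (A * Y * A * X)" using X Y by metis
  also have "\<dots> = transpose_mat ((A * Y) * (A * X))" by (simp add: mult_assoc_dim)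
  also have "\<dots> = (A * X) * (A * Y)" using X Y by (subst transpose_mult_dim) auto
  also have "\<dots> = (A * X * A) * Y" by (simp add: mult_assoc_dim)
  finally have AXY: "A * X = A * Y" using X by simp
  have "X * A = transpose_mat (X * (A * Y * A))" using X Y by metis
  also have "\<dots> = transpose_mat ((X * A) * (Y * A))" by (simp add: mult_assoc_dim)
  also have "\<dots> = (Y * A) * (X * A)" using X Y by (subst transpose_mult_dim) auto
  also have "\<dots> = Y * (A * X * A)" by (simp add: mult_assoc_dim)
  finally have XYA: "X * A = Y * A" using X by simp
  have "X = X * (A * X)" using X by (simp add: mult_assoc_dim)
  also have "\<dots> = (X * A) * Y" unfolding AXY by (simp add: mult_assoc_dim)
  also have "\<dots> = Y" unfolding XYA using Y by simp
  finally show ?thesis .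
qed

lemma mp_inverse: "is_mp_inverse A (mp_inverse A)"
proof -
  have "\<exists>!X. is_mp_inverse A X" using mp_inverse_exists is_mp_inverse_unique by blast
  from theI'[OF this] show ?thesis unfolding mp_inverse_def is_mp_inverse_def .
qed

lemma mp_inverse_dim [simp]:
  "dim_row (mp_inverse A) = dim_col A" "dim_col (mp_inverse A) = dim_row A"
  using mp_inverse[of A] by (auto simp: is_mp_inverse_def)

lemma mp_inverse_props:
  "A * mp_inverse A * A = A" "mp_inverse A * A * mp_inverse A = mp_inverse A"
  "transpose_mat (A * mp_inverse A) = A * mp_inverse A"
  "transpose_mat (mp_inverse A * A) = mp_inverse A * A"
  using mp_inverse[of A] by (auto simp: is_mp_inverse_def)

section \<open>Projectors determined by range and null space\<close>

lemma range_proj_fixes: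
  assumes "dim_row B = dim_row A" and "mat_range B \<subseteq> mat_range A"
  shows "A * mp_inverse A * B = B"
proof (rule eq_matI)
  fix i j assume ij: "i < dim_row B" "j < dim_col B"
  have "col B j = B *\<^sub>v unit_vec (dim_col B) j" using ij by auto
  then have "col B j \<in> mat_range B"
    unfolding mat_range_def by (intro CollectI exI[of _ "unit_vec (dim_col B) j"] conjI) auto
  then have "col B j \<in> mat_range A" using assms(2) by auto
  then obtain x where x: "x \<in> carrier_vec (dim_col A)" "col B j = A *\<^sub>v x" by (auto simp: mat_range_def)
  have "(A * mp_inverse A) *\<^sub>v col B j = (A * mp_inverse A * A) *\<^sub>v x"
    unfolding x(2) by (rule assoc_mult_mat_vec[symmetric, of _ "dim_row A" "dim_row A" _ "dim_col A"]) (use x(1) in auto)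
  then have "(A * mp_inverse A) *\<^sub>v col B j = col B j" by (simp add: mp_inverse_props x)
  from arg_cong[OF this, of "\<lambda>v. v $ i"] show "(A * mp_inverse A * B) $$ (i,j) = B $$ (i,j)"
    using ij assms(1) by simp
qed (use assms in auto)

text \<open>Each projector fixes the range of the other. Transposing one of the two absorption
  identities makes both describe the same product.\<close>

lemma range_proj_eq:
  assumes d: "dim_row P = dim_row A" and r: "mat_range P = mat_range A"
  shows "P * mp_inverse P = A * mp_inverse A"
proof -
  let ?p = "P * mp_inverse P" and ?a = "A * mp_inverse A"
  have "?a * ?p = ?p"
    using range_proj_fixes[of P A] assms by (simp add: mult_assoc_dim[symmetric])
  moreover have "?p * ?a = ?a"
    using range_proj_fixes[of A P] assms by (simp add: mult_assoc_dim[symmetric])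
  then have "transpose_mat (?p * ?a) = ?a" by (simp add: mp_inverse_props)
  then have "?a * ?p = ?a" using d by (subst (asm) transpose_mult_dim) (simp_all add: mp_inverse_props)
  ultimately show ?thesis by simp
qed

text \<open>The columns of \<open>I - mp_inverse A * A\<close> lie in the null space of
  \<open>A\<close>, so \<open>P\<close> annihilates them.\<close>

lemma null_proj_fixes:
  assumes d: "dim_col P = dim_col A" and r: "mat_null A \<subseteq> mat_null P"
  shows "P * (mp_inverse A * A) = P"
proof (rule eq_matI)
  let ?q = "mp_inverse A * A" and ?n = "dim_col A"
  fix i j assume ij: "i < dim_row P" "j < dim_col P"
  define x where "x = unit_vec ?n j - col ?q j"
  have x: "x \<in> carrier_vec ?n" by (rule carrier_vecI) (simp add: x_def)
  have "A *\<^sub>v x = A *\<^sub>v unit_vec ?n j - A *\<^sub>v col ?q j"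
    unfolding x_def by (rule mult_minus_distrib_mat_vec[of _ "dim_row A" ?n]) (use ij d in \<open>auto intro!: carrier_vecI\<close>)
  also have "A *\<^sub>v unit_vec ?n j = col A j" using ij d by auto
  also have "A *\<^sub>v col ?q j = col (A * mp_inverse A * A) j"
    using ij d by (subst mult_assoc_dim, simp, simp, subst col_mult2[of A "dim_row A" ?n ?q ?n]) (auto intro: carrier_matI)
  finally have "A *\<^sub>v x = col A j - col A j" unfolding mp_inverse_props .
  then have "A *\<^sub>v x = 0\<^sub>v (dim_row A)" by (simp only: minus_cancel_vec[OF col_dim])
  then have "x \<in> mat_null A" unfolding mat_null_def mat_kernel_def using x by blast
  then have "x \<in> mat_null P" using r by blast
  then have "P *\<^sub>v x = 0\<^sub>v (dim_row P)" unfolding mat_null_def mat_kernel_def by blast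
  moreover have "P *\<^sub>v x = P *\<^sub>v unit_vec ?n j - P *\<^sub>v col ?q j"
    unfolding x_def by (rule mult_minus_distrib_mat_vec[of _ "dim_row P" ?n]) (use ij d in \<open>auto intro!: carrier_vecI\<close>)
  moreover have "P *\<^sub>v unit_vec ?n j = col P j" using ij d by auto
  ultimately have "col P j - P *\<^sub>v col ?q j = 0\<^sub>v (dim_row P)" by simp
  from arg_cong[OF this, of "\<lambda>v. v $ i"] show "(P * ?q) $$ (i,j) = P $$ (i,j)"
    using ij d by simp
qed (use assms in auto)

lemma null_proj_eq:
  assumes d: "dim_col P = dim_col A" and r: "mat_null P = mat_null A"
  shows "mp_inverse P * P = mp_inverse A * A"
proof -
  let ?p = "mp_inverse P * P" and ?a = "mp_inverse A * A"
  have "?p * ?a = ?p"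
    using null_proj_fixes[of P A] assms by (simp add: mult_assoc_dim)
  moreover have "?a * ?p = ?a"
    using null_proj_fixes[of A P] assms by (simp add: mult_assoc_dim)
  then have "transpose_mat (?a * ?p) = ?a" by (simp add: mp_inverse_props)
  then have "?p * ?a = ?a" using d by (subst (asm) transpose_mult_dim) (simp_all add: mp_inverse_props)
  ultimately show ?thesis by simp
qed

section \<open>Entrywise order on matrices\<close>

lemma mat_leI:
  "dim_row A = dim_row B \<Longrightarrow> dim_col A = dim_col B \<Longrightarrow>
    (\<And>i j. i < dim_row B \<Longrightarrow> j < dim_col B \<Longrightarrow> A $$ (i,j) \<le> B $$ (i,j)) \<Longrightarrow> A \<le> B"
  by (auto simp: less_eq_mat_def)

lemma mat_leD: "A \<le> B \<Longrightarrow> i < dim_row B \<Longrightarrow> j < dim_col B \<Longrightarrow> A $$ (i,j) \<le> B $$ (i,j)"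
  by (auto simp: less_eq_mat_def)

text \<open>The order on matrices includes equality of dimensions, so a bound by a zero matrix also
  serves as a carrier statement below.\<close>

lemma mat_le_dim: "A \<le> B \<Longrightarrow> dim_row A = dim_row B" "A \<le> B \<Longrightarrow> dim_col A = dim_col B"
  by (auto simp: less_eq_mat_def)

lemma mat_mult_left_mono:
  fixes A :: "'a :: linordered_idom mat"
  assumes A: "0\<^sub>m r (dim_row X) \<le> A" and XY: "X \<le> Y"
  shows "A * X \<le> A * Y"
proof -
  have d: "dim_row A = r" "dim_col A = dim_row X" "dim_row Y = dim_row X" "dim_col Y = dim_col X"
    using mat_le_dim[OF A] mat_le_dim[OF XY] by auto
  show ?thesis
  proof (rule mat_leI)
    fix i j assume ij: "i < dim_row (A * Y)" "j < dim_col (A * Y)"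
    have "(\<Sum>l = 0..<dim_row X. A $$ (i,l) * X $$ (l,j)) \<le> (\<Sum>l = 0..<dim_row X. A $$ (i,l) * Y $$ (l,j))"
      using mat_leD[OF A] mat_leD[OF XY] ij d by (intro sum_mono mult_left_mono) auto
    then show "(A * X) $$ (i,j) \<le> (A * Y) $$ (i,j)" using ij d by (simp add: scalar_prod_def)
  qed (use d in auto)
qed

lemma mat_mult_right_mono:
  fixes A :: "'a :: linordered_idom mat"
  assumes A: "0\<^sub>m (dim_col X) c \<le> A" and XY: "X \<le> Y"
  shows "X * A \<le> Y * A"
proof -
  have d: "dim_row A = dim_col X" "dim_col A = c" "dim_row Y = dim_row X" "dim_col Y = dim_col X"
    using mat_le_dim[OF A] mat_le_dim[OF XY] by auto
  show ?thesis
  proof (rule mat_leI)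
    fix i j assume ij: "i < dim_row (Y * A)" "j < dim_col (Y * A)"
    have "(\<Sum>l = 0..<dim_col X. X $$ (i,l) * A $$ (l,j)) \<le> (\<Sum>l = 0..<dim_col X. Y $$ (i,l) * A $$ (l,j))"
      using mat_leD[OF A] mat_leD[OF XY] ij d by (intro sum_mono mult_right_mono) auto
    then show "(X * A) $$ (i,j) \<le> (Y * A) $$ (i,j)" using ij d by (simp add: scalar_prod_def)
  qed (use d in auto)
qed

lemma mat_mult_nonneg:
  fixes A B :: "'a :: linordered_idom mat"
  assumes A: "0\<^sub>m r k \<le> A" and B: "0\<^sub>m k c \<le> B"
  shows "0\<^sub>m r c \<le> A * B"
  using mat_mult_left_mono[of r "0\<^sub>m k c" A B] assms mat_le_dim[OF A] by simp

lemma smult_mat_mono: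
  fixes X Y :: "'a :: linordered_idom mat"
  shows "0 \<le> a \<Longrightarrow> X \<le> Y \<Longrightarrow> a \<cdot>\<^sub>m X \<le> a \<cdot>\<^sub>m Y"
  by (auto simp: less_eq_mat_def intro: mult_left_mono)

section \<open>Subinvariant vectors and the spectral radius\<close>

lemma rspectral_radius_attained:
  assumes M: "M \<in> carrier_mat k k" and "k > 0"
  obtains \<mu> v where "cmod \<mu> = rspectral_radius M" "v \<in> carrier_vec k" "v \<noteq> 0\<^sub>v k"
    "map_mat complex_of_real M *\<^sub>v v = \<mu> \<cdot>\<^sub>v v"
proof -
  let ?M = "map_mat complex_of_real M"
  have M': "?M \<in> carrier_mat k k" using M by simp
  from spectral_radius_mem_max(1)[OF M' \<open>k > 0\<close>] obtain \<mu> where "\<mu> \<in> spectrum ?M"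
    "cmod \<mu> = rspectral_radius M" by (auto simp: rspectral_radius_def)
  then show ?thesis using M that by (auto simp: spectrum_def eigenvalue_def eigenvector_def)
qed

lemma rspectral_radius_nonneg:
  assumes "M \<in> carrier_mat k k" "k > 0"
  shows "0 \<le> rspectral_radius M"
  using rspectral_radius_attained[OF assms] norm_ge_zero by metis

lemma rspectral_radius_transpose:
  assumes M: "M \<in> carrier_mat k k"
  shows "rspectral_radius (transpose_mat M) = rspectral_radius M"
proof -
  let ?M = "map_mat complex_of_real M"
  have M': "?M \<in> carrier_mat k k" using M by simp
  have "map_mat complex_of_real (transpose_mat M) = transpose_mat ?M" by (intro eq_matI) auto
  moreover have "spectrum (transpose_mat ?M) = spectrum ?M"
    using M' by (simp add: spectrum_root_char_poly[of _ k])
  ultimately show ?thesis by (simp add: rspectral_radius_def spectral_radius_def)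
qed

text \<open>The entrywise modulus of an eigenvector of maximal modulus is subinvariant.\<close>

lemma subinvariant_col_exists:
  assumes M: "M \<in> carrier_mat k k" and k: "k > 0" and nonneg: "0\<^sub>m k k \<le> M"
  obtains X where "X \<in> carrier_mat k 1" "0\<^sub>m k 1 \<le> X" "X \<noteq> 0\<^sub>m k 1"
    "rspectral_radius M \<cdot>\<^sub>m X \<le> M * X"
proof -
  from rspectral_radius_attained[OF M k] obtain \<mu> v where lam: "cmod \<mu> = rspectral_radius M"
    and v: "v \<in> carrier_vec k" "v \<noteq> 0\<^sub>v k" and ev: "map_mat complex_of_real M *\<^sub>v v = \<mu> \<cdot>\<^sub>v v" by blast
  define X where "X = mat k 1 (\<lambda>(i,j). cmod (v $ i))"
  have [simp]: "dim_row M = k" "dim_col M = k" "dim_row X = k" "dim_col X = 1" "dim_vec v = k"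
    using M v by (auto simp: X_def)
  have "\<exists>i<k. v $ i \<noteq> 0" using v by (metis eq_vecI index_zero_vec carrier_vecD)
  then have "X \<noteq> 0\<^sub>m k 1" by (auto simp: X_def mat_eq_iff)
  moreover have "rspectral_radius M \<cdot>\<^sub>m X \<le> M * X"
  proof (rule mat_leI)
    fix i j assume "i < dim_row (M * X)" "j < dim_col (M * X)"
    then have ij: "i < k" "j = 0" by auto
    \<comment> \<open>Triangle inequality in row \<open>i\<close> of the eigenvalue equation; the
      entries of \<open>M\<close> are their own moduli.\<close>
    have "cmod (\<mu> * v $ i) = cmod ((map_mat complex_of_real M *\<^sub>v v) $ i)" using ij by (simp add: ev)
    also have "\<dots> = cmod (\<Sum>l = 0..<k. complex_of_real (M $$ (i,l)) * v $ l)"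
      using ij by (simp add: scalar_prod_def)
    also have "\<dots> \<le> (\<Sum>l = 0..<k. cmod (complex_of_real (M $$ (i,l)) * v $ l))" by (rule norm_sum)
    also have "\<dots> = (\<Sum>l = 0..<k. M $$ (i,l) * cmod (v $ l))"
      using mat_leD[OF nonneg] ij by (intro sum.cong) (auto simp: norm_mult)
    finally show "(rspectral_radius M \<cdot>\<^sub>m X) $$ (i,j) \<le> (M * X) $$ (i,j)"
      using ij by (simp add: norm_mult lam scalar_prod_def) (simp add: X_def)
  qed auto
  ultimately show ?thesis by (intro that[of X]) (auto simp: X_def intro!: mat_leI)
qed

text \<open>The Jordan normal form bounds the complex powers uniformly when the spectral radius is
  below 1; the embedding of the reals commutes with powers.\<close>

lemma powers_bounded:
  assumes M: "M \<in> carrier_mat k k" and k: "k > 0" and rho: "rspectral_radius M < 1"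
  obtains c where "\<And>l i j. i < k \<Longrightarrow> j < k \<Longrightarrow> \<bar>(M ^\<^sub>m l) $$ (i,j)\<bar> \<le> c"
proof -
  let ?M = "map_mat complex_of_real M"
  have M': "?M \<in> carrier_mat k k" using M by simp
  from spectral_radius_jnf_norm_bound_less_1_upper_triangular[OF M'] rho
  obtain c where c: "\<And>l. norm_bound (?M ^\<^sub>m l) c" by (auto simp: rspectral_radius_def)
  have "\<bar>(M ^\<^sub>m l) $$ (i,j)\<bar> \<le> c" if ij: "i < k" "j < k" for l i j
  proof -
    have "?M ^\<^sub>m l = map_mat complex_of_real (M ^\<^sub>m l)" by (rule of_real_hom.mat_hom_pow[OF M, symmetric])
    then have "(?M ^\<^sub>m l) $$ (i,j) = complex_of_real ((M ^\<^sub>m l) $$ (i,j))" using ij M by simp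
    moreover have "cmod ((?M ^\<^sub>m l) $$ (i,j)) \<le> c"
      using c[of l] ij pow_carrier_mat[OF M', of l] unfolding norm_bound_def by (metis carrier_matD)
    ultimately show ?thesis by simp
  qed
  then show ?thesis by (rule that)
qed

text \<open>An eigenvector of \<open>s \<cdot>\<^sub>m M\<close> for \<mu> is an eigenvector of
  \<open>M\<close> for \<mu> / s.\<close>

lemma rspectral_radius_smult:
  assumes M: "M \<in> carrier_mat k k" and k: "k > 0" and s: "s > 0"
  shows "rspectral_radius (s \<cdot>\<^sub>m M) \<le> s * rspectral_radius M"
proof -
  let ?M = "map_mat complex_of_real M"
  have sM: "s \<cdot>\<^sub>m M \<in> carrier_mat k k" using M by simp
  from rspectral_radius_attained[OF sM k] obtain \<mu> v where lam: "cmod \<mu> = rspectral_radius (s \<cdot>\<^sub>m M)"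
    and v: "v \<in> carrier_vec k" "v \<noteq> 0\<^sub>v k"
    and ev: "map_mat complex_of_real (s \<cdot>\<^sub>m M) *\<^sub>v v = \<mu> \<cdot>\<^sub>v v" by blast
  have M': "?M \<in> carrier_mat k k" using M by simp
  have "map_mat complex_of_real (s \<cdot>\<^sub>m M) = complex_of_real s \<cdot>\<^sub>m ?M" by (intro eq_matI) auto
  with ev have "(complex_of_real s \<cdot>\<^sub>m ?M) *\<^sub>v v = \<mu> \<cdot>\<^sub>v v" by simp
  then have ev': "(complex_of_real s \<cdot>\<^sub>m ?M *\<^sub>v v) $ i = (\<mu> \<cdot>\<^sub>v v) $ i" for i by simp
  have "?M *\<^sub>v v = (\<mu> / s) \<cdot>\<^sub>v v"
  proof (rule eq_vecI)
    fix i assume "i < dim_vec ((\<mu> / complex_of_real s) \<cdot>\<^sub>v v)"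
    then have i: "i < k" using v by simp
    have "complex_of_real s * (?M *\<^sub>v v) $ i = \<mu> * v $ i"
      using ev'[of i] i v M by (simp add: scalar_prod_def sum_distrib_left mult.assoc)
    then show "(?M *\<^sub>v v) $ i = ((\<mu> / complex_of_real s) \<cdot>\<^sub>v v) $ i"
      using s i v by (simp add: field_simps del: index_mult_mat_vec)
  qed (use M v in auto)
  then have "eigenvalue ?M (\<mu> / s)" unfolding eigenvalue_def eigenvector_def using v M by auto
  then have "cmod (\<mu> / s) \<in> norm ` spectrum ?M" by (auto simp: spectrum_def)
  from spectral_radius_mem_max(2)[OF M' k this]
  show ?thesis using s lam by (simp add: rspectral_radius_def norm_divide divide_le_eq mult.commute)
qed

text \<open>Otherwise a rescaling of \<open>M\<close> has bounded powers, while they blow up along \<open>X\<close>.\<close>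

lemma subinvariant_col_le_rspectral_radius:
  assumes M: "M \<in> carrier_mat k k" and nonneg: "0\<^sub>m k k \<le> M"
    and X: "X \<in> carrier_mat k 1" "0\<^sub>m k 1 \<le> X" "X \<noteq> 0\<^sub>m k 1" and sub: "r \<cdot>\<^sub>m X \<le> M * X"
  shows "r \<le> rspectral_radius M"
proof (rule ccontr)
  have [simp]: "dim_row M = k" "dim_col M = k" "dim_row X = k" "dim_col X = 1" using M X by auto
  from X(3) obtain i where i: "i < k" "X $$ (i,0) \<noteq> 0" by (auto simp: mat_eq_iff)
  with mat_leD[OF X(2), of i 0] have Xi: "X $$ (i,0) > 0" by simp
  from i have k: "k > 0" by simp
  assume "\<not> r \<le> rspectral_radius M"
  then have "rspectral_radius M < r" by simp
  \<comment> \<open>Dividing by an intermediate \<open>s\<close> puts the spectral radius below 1,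
    while the growth factor \<open>q = r / s\<close> along \<open>X\<close> stays above 1.\<close>
  then obtain s where s: "rspectral_radius M < s" "s < r" using dense by blast
  then have s0: "s > 0" and r0: "r > 0" using rspectral_radius_nonneg[OF M k] by auto
  define N where "N = (1 / s) \<cdot>\<^sub>m M"
  have N: "N \<in> carrier_mat k k" by (auto simp: N_def)
  have [simp]: "dim_row N = k" "dim_col N = k" by (auto simp: N_def)
  have "rspectral_radius N \<le> (1 / s) * rspectral_radius M"
    unfolding N_def using s0 by (intro rspectral_radius_smult[OF M k]) auto
  also have "\<dots> < 1" using s s0 by simp
  finally have "rspectral_radius N < 1" .
  from powers_bounded[OF N k this] obtain c where c: "\<And>l i j. i < k \<Longrightarrow> j < k \<Longrightarrow> \<bar>(N ^\<^sub>m l) $$ (i,j)\<bar> \<le> c"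
    by blast
  have nonneg_N: "0\<^sub>m k k \<le> N" unfolding N_def using mat_leD[OF nonneg] s0 by (intro mat_leI) auto
  define q where "q = r / s"
  have q: "q > 1" using s s0 by (simp add: q_def)
  have "q \<cdot>\<^sub>m X = (1 / s) \<cdot>\<^sub>m (r \<cdot>\<^sub>m X)" by (intro eq_matI) (auto simp: q_def)
  also have "\<dots> \<le> (1 / s) \<cdot>\<^sub>m (M * X)" using s0 sub by (intro smult_mat_mono) auto
  finally have step: "q \<cdot>\<^sub>m X \<le> N * X" by (simp add: N_def smult_mult_dim)
  have nonneg_pow: "0\<^sub>m k k \<le> N ^\<^sub>m l" for l
  proof (induction l)
    case 0
    show ?case by (intro mat_leI) auto
  next
    case (Suc l)
    then show ?case using mat_mult_nonneg[OF Suc nonneg_N] by simp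
  qed
  have grow: "q ^ l \<cdot>\<^sub>m X \<le> N ^\<^sub>m l * X" for l
  proof (induction l)
    case 0
    show ?case by (intro mat_leI) auto
  next
    case (Suc l)
    have "q ^ Suc l \<cdot>\<^sub>m X = q \<cdot>\<^sub>m (q ^ l \<cdot>\<^sub>m X)" by (intro eq_matI) auto
    also have "\<dots> \<le> q \<cdot>\<^sub>m (N ^\<^sub>m l * X)" using q Suc by (intro smult_mat_mono) auto
    also have "\<dots> = N ^\<^sub>m l * (q \<cdot>\<^sub>m X)" by (simp add: mult_smult_dim)
    also have "\<dots> \<le> N ^\<^sub>m l * (N * X)"
      using nonneg_pow[of l] step by (intro mat_mult_left_mono[of k]) auto
    also have "\<dots> = N ^\<^sub>m Suc l * X" by (simp add: mult_assoc_dim)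
    finally show ?case .
  qed
  define K where "K = (\<Sum>j = 0..<k. c * X $$ (j,0))"
  have bound: "q ^ l * X $$ (i,0) \<le> K" for l
  proof -
    have "q ^ l * X $$ (i,0) \<le> (N ^\<^sub>m l * X) $$ (i,0)" using mat_leD[OF grow[of l], of i 0] i by simp
    also have "\<dots> = (\<Sum>j = 0..<k. (N ^\<^sub>m l) $$ (i,j) * X $$ (j,0))" using i by (simp add: scalar_prod_def)
    also have "\<dots> \<le> K" unfolding K_def
      using c[of i _ l] i mat_leD[OF X(2)] by (intro sum_mono mult_right_mono) (auto simp: abs_le_iff)
    finally show ?thesis .
  qed
  obtain l where "K / X $$ (i,0) < q ^ l" using real_arch_pow[OF q] by blast
  with bound[of l] Xi show False by (simp add: field_simps)
qed

lemma subinvariant_row_exists: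
  assumes M: "M \<in> carrier_mat k k" and k: "k > 0" and nonneg: "0\<^sub>m k k \<le> M"
  obtains Y where "Y \<in> carrier_mat 1 k" "0\<^sub>m 1 k \<le> Y" "Y \<noteq> 0\<^sub>m 1 k"
    "rspectral_radius M \<cdot>\<^sub>m Y \<le> Y * M"
proof -
  have "transpose_mat M \<in> carrier_mat k k" "0\<^sub>m k k \<le> transpose_mat M"
    using M nonneg by (auto simp: less_eq_mat_def)
  from subinvariant_col_exists[OF this(1) k this(2)] obtain X where
    X: "X \<in> carrier_mat k 1" "0\<^sub>m k 1 \<le> X" "X \<noteq> 0\<^sub>m k 1"
    and sub: "rspectral_radius M \<cdot>\<^sub>m X \<le> transpose_mat M * X"
    by (auto simp: rspectral_radius_transpose[OF M])
  have [simp]: "dim_row M = k" "dim_col M = k" "dim_row X = k" "dim_col X = 1" using M X by auto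
  show ?thesis
  proof (rule that)
    show "transpose_mat X \<noteq> 0\<^sub>m 1 k" using X(3) by (metis transpose_transpose zero_transpose_mat)
    have "transpose_mat X * M = transpose_mat (transpose_mat M * X)" by (simp add: transpose_mult_dim)
    then show "rspectral_radius M \<cdot>\<^sub>m transpose_mat X \<le> transpose_mat X * M"
      using sub by (simp add: less_eq_mat_def del: index_mult_mat(1))
  qed (use X in \<open>auto simp: less_eq_mat_def\<close>)
qed

lemma subinvariant_row_le_rspectral_radius:
  assumes M: "M \<in> carrier_mat k k" and nonneg: "0\<^sub>m k k \<le> M"
    and Y: "Y \<in> carrier_mat 1 k" "0\<^sub>m 1 k \<le> Y" "Y \<noteq> 0\<^sub>m 1 k" and sub: "r \<cdot>\<^sub>m Y \<le> Y * M"
  shows "r \<le> rspectral_radius M"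
proof -
  have [simp]: "dim_row M = k" "dim_col M = k" "dim_row Y = 1" "dim_col Y = k" using M Y by auto
  have "transpose_mat M * transpose_mat Y = transpose_mat (Y * M)" by (simp add: transpose_mult_dim)
  then have "r \<cdot>\<^sub>m transpose_mat Y \<le> transpose_mat M * transpose_mat Y"
    using sub by (simp add: less_eq_mat_def del: index_mult_mat(1))
  moreover have "transpose_mat Y \<noteq> 0\<^sub>m k 1" using Y(3) by (metis transpose_transpose zero_transpose_mat)
  ultimately have "r \<le> rspectral_radius (transpose_mat M)"
    using M nonneg Y by (intro subinvariant_col_le_rspectral_radius[of _ k "transpose_mat Y"])
      (auto simp: less_eq_mat_def)
  then show ?thesis by (simp add: rspectral_radius_transpose[OF M])
qed

section \<open>Block companion matrices\<close>

text \<open>Block companion matrix of the two-step iteration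
  \<open>x_(k+1) = B x_k + C x_(k-1)\<close>; its eigenvalues belong to the quadratic problem
  \<open>r^2 x = r B x + C x\<close>.\<close>

abbreviation double_iteration_mat :: "real mat \<Rightarrow> real mat \<Rightarrow> real mat" where
  "double_iteration_mat B C \<equiv>
    four_block_mat B C (1\<^sub>m (dim_row B)) (0\<^sub>m (dim_row B) (dim_row B))"

lemma double_iteration_mat_nonneg:
  assumes "0\<^sub>m n n \<le> B" "0\<^sub>m n n \<le> C"
  shows "0\<^sub>m (n + n) (n + n) \<le> double_iteration_mat B C"
  using assms by (auto simp: less_eq_mat_def one_mat_def)

text \<open>Halving the subinvariant row into \<open>y\<close> and \<open>w\<close> gives
  \<open>r y <= y B + w\<close> and \<open>r w <= y C\<close>; multiplying the first by
  \<open>r\<close> eliminates \<open>w\<close>.\<close>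

lemma double_iteration_row:
  assumes n: "n > 0" and B: "0\<^sub>m n n \<le> B" and C: "0\<^sub>m n n \<le> C"
    and r: "r = rspectral_radius (double_iteration_mat B C)" "r > 0"
  obtains y where "y \<in> carrier_mat 1 n" "0\<^sub>m 1 n \<le> y" "y \<noteq> 0\<^sub>m 1 n"
    "r\<^sup>2 \<cdot>\<^sub>m y \<le> r \<cdot>\<^sub>m (y * B) + y * C"
proof -
  have [simp]: "dim_row B = n" "dim_col B = n" "dim_row C = n" "dim_col C = n"
    using mat_le_dim[OF B] mat_le_dim[OF C] by auto
  let ?M = "double_iteration_mat B C"
  have M: "?M \<in> carrier_mat (n + n) (n + n)" by auto
  from subinvariant_row_exists[OF M _ double_iteration_mat_nonneg[OF B C]] n
  obtain Y where Y: "Y \<in> carrier_mat 1 (n + n)" "0\<^sub>m 1 (n + n) \<le> Y" "Y \<noteq> 0\<^sub>m 1 (n + n)"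
    and sub: "r \<cdot>\<^sub>m Y \<le> Y * ?M" using r by auto
  define y where "y = mat 1 n (\<lambda>(i,j). Y $$ (i,j))"
  define w where "w = mat 1 n (\<lambda>(i,j). Y $$ (i,j + n))"
  have [simp]: "dim_row y = 1" "dim_col y = n" "dim_row w = 1" "dim_col w = n" by (auto simp: y_def w_def)
  \<comment> \<open>Lower blocks without rows make the row a block matrix, so that block
    multiplication applies.\<close>
  have Y_eq: "Y = four_block_mat y w (0\<^sub>m 0 n) (0\<^sub>m 0 n)"
    using Y by (intro eq_matI) (auto simp: y_def w_def)
  have YM: "Y * ?M = four_block_mat (y * B + w) (y * C) (0\<^sub>m 0 n) (0\<^sub>m 0 n)"
    unfolding Y_eq by (subst mult_four_block_mat[of _ 1 n _ n _ 0 _ _ n _ n]) auto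
  have y0: "0\<^sub>m 1 n \<le> y" and w0: "0\<^sub>m 1 n \<le> w"
    using mat_leD[OF Y(2)] Y(1) by (auto simp: y_def w_def intro!: mat_leI)
  have s1: "r * y $$ (0,j) \<le> (y * B) $$ (0,j) + w $$ (0,j)" if "j < n" for j
    using mat_leD[OF sub[unfolded YM, unfolded Y_eq], of 0 j] that by (simp del: index_mult_mat(1))
  have s2: "r * w $$ (0,j) \<le> (y * C) $$ (0,j)" if "j < n" for j
    using mat_leD[OF sub[unfolded YM, unfolded Y_eq], of 0 "j + n"] that by (simp del: index_mult_mat(1))
  have "r\<^sup>2 \<cdot>\<^sub>m y \<le> r \<cdot>\<^sub>m (y * B) + y * C"
  proof (rule mat_leI)
    fix i j assume "i < dim_row (r \<cdot>\<^sub>m (y * B) + y * C)" "j < dim_col (r \<cdot>\<^sub>m (y * B) + y * C)"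
    then have ij: "i = 0" "j < n" by auto
    have "r * (r * y $$ (0,j)) \<le> r * ((y * B) $$ (0,j) + w $$ (0,j))"
      using s1[OF ij(2)] r by (intro mult_left_mono) auto
    also have "\<dots> \<le> r * (y * B) $$ (0,j) + (y * C) $$ (0,j)" using s2[OF ij(2)] by (simp only: distrib_left add_left_mono)
    finally show "(r\<^sup>2 \<cdot>\<^sub>m y) $$ (i,j) \<le> (r \<cdot>\<^sub>m (y * B) + y * C) $$ (i,j)"
      using ij by (simp add: power2_eq_square mult.assoc del: index_mult_mat(1))
  qed auto
  \<comment> \<open>If \<open>y\<close> vanished, \<open>r w <= y C = 0\<close> with
    \<open>r > 0\<close> would force \<open>w = 0\<close> as well.\<close>
  moreover have "y \<noteq> 0\<^sub>m 1 n"
  proof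
    assume y: "y = 0\<^sub>m 1 n"
    then have "y * C = 0\<^sub>m 1 n" by simp
    have "w = 0\<^sub>m 1 n"
    proof (rule eq_matI)
      fix i j assume "i < dim_row (0\<^sub>m 1 n :: real mat)" "j < dim_col (0\<^sub>m 1 n :: real mat)"
      then have ij: "i = 0" "j < n" by auto
      have "r * w $$ (0,j) \<le> 0" using s2[OF ij(2)] ij unfolding \<open>y * C = _\<close> by simp
      then have "w $$ (0,j) \<le> 0" using r by (simp add: mult_le_0_iff)
      then show "w $$ (i,j) = 0\<^sub>m 1 n $$ (i,j)" using mat_leD[OF w0, of 0 j] ij by simp
    qed auto
    with y have "Y = 0\<^sub>m 1 (n + n)" unfolding Y_eq by (intro eq_matI) auto
    with Y(3) show False by simp
  qed
  ultimately show ?thesis using y0 by (intro that[of y]) auto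
qed

text \<open>The stacked column of \<open>r v\<close> over \<open>v\<close> is subinvariant: the
  upper block is the hypothesis, the lower one an equality.\<close>

lemma double_iteration_col:
  assumes B: "0\<^sub>m n n \<le> B" and C: "0\<^sub>m n n \<le> C" and "r \<ge> 0"
    and v: "v \<in> carrier_mat n 1" "0\<^sub>m n 1 \<le> v" "v \<noteq> 0\<^sub>m n 1"
    and sub: "r\<^sup>2 \<cdot>\<^sub>m v \<le> r \<cdot>\<^sub>m (B * v) + C * v"
  shows "r \<le> rspectral_radius (double_iteration_mat B C)"
proof -
  have [simp]: "dim_row B = n" "dim_col B = n" "dim_row C = n" "dim_col C = n" "dim_row v = n" "dim_col v = 1"
    using mat_le_dim[OF B] mat_le_dim[OF C] v by auto
  have carr: "B \<in> carrier_mat n n" "C \<in> carrier_mat n n" by auto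
  let ?M = "double_iteration_mat B C"
  define X where "X = four_block_mat (r \<cdot>\<^sub>m v) (0\<^sub>m n 0) v (0\<^sub>m n 0)"
  have [simp]: "dim_row X = n + n" "dim_col X = 1" by (auto simp: X_def)
  have MX: "?M * X = four_block_mat (r \<cdot>\<^sub>m (B * v) + C * v) (0\<^sub>m n 0) (r \<cdot>\<^sub>m v) (0\<^sub>m n 0)"
  proof -
    have carr': "r \<cdot>\<^sub>m v \<in> carrier_mat n 1" "v \<in> carrier_mat n 1" using v by simp_all
    have "1\<^sub>m n * (r \<cdot>\<^sub>m v) + 0\<^sub>m n n * v = r \<cdot>\<^sub>m v" by (rule eq_matI) simp_all
    moreover have "1\<^sub>m n * 0\<^sub>m n 0 + 0\<^sub>m n n * 0\<^sub>m n 0 = (0\<^sub>m n 0 :: real mat)"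
      and "B * 0\<^sub>m n 0 + C * 0\<^sub>m n 0 = 0\<^sub>m n 0" by (rule eq_matI; simp)+
    ultimately show ?thesis unfolding X_def
      using mult_four_block_mat[OF carr one_carrier_mat zero_carrier_mat carr'(1) zero_carrier_mat carr'(2) zero_carrier_mat]
      by (simp add: mult_smult_dim)
  qed
  have M: "?M \<in> carrier_mat (n + n) (n + n)" by auto
  show ?thesis
  proof (rule subinvariant_col_le_rspectral_radius[OF M double_iteration_mat_nonneg[OF B C]])
    show "X \<in> carrier_mat (n + n) 1" by auto
    show "0\<^sub>m (n + n) 1 \<le> X" unfolding X_def
      using mat_leD[OF v(2)] \<open>r \<ge> 0\<close> by (intro mat_leI) auto
    from v(3) obtain i where i: "i < n" "v $$ (i,0) \<noteq> 0" by (auto simp: mat_eq_iff)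
    then have "X $$ (n + i,0) \<noteq> 0" unfolding X_def by simp
    then show "X \<noteq> 0\<^sub>m (n + n) 1" using i by auto
    show "r \<cdot>\<^sub>m X \<le> ?M * X" unfolding MX
    proof (rule mat_leI)
      fix i j
      assume "i < dim_row (four_block_mat (r \<cdot>\<^sub>m (B * v) + C * v) (0\<^sub>m n 0) (r \<cdot>\<^sub>m v) (0\<^sub>m n 0))"
        "j < dim_col (four_block_mat (r \<cdot>\<^sub>m (B * v) + C * v) (0\<^sub>m n 0) (r \<cdot>\<^sub>m v) (0\<^sub>m n 0))"
      then have ij: "i < n + n" "j = 0" by auto
      then show "(r \<cdot>\<^sub>m X) $$ (i,j) \<le> four_block_mat (r \<cdot>\<^sub>m (B * v) + C * v) (0\<^sub>m n 0) (r \<cdot>\<^sub>m v) (0\<^sub>m n 0) $$ (i,j)"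
        using mat_leD[OF sub, of i 0] unfolding X_def
        by (simp add: power2_eq_square mult.assoc del: index_mult_mat(1))
    qed auto
  qed
qed

section \<open>Convergence and comparison\<close>

text \<open>Applied to both iteration matrices. For \<open>T_1\<close> the bound \<open>D_ge\<close>
  comes from an equation; for \<open>W_12\<close> it is a genuine inequality.\<close>

lemma double_iteration_lt_1:
  assumes n: "n > 0" and D: "0\<^sub>m n m \<le> D" and X: "0\<^sub>m n m \<le> X"
    and RU: "R \<in> carrier_mat m n" "U \<in> carrier_mat m n"
    and B: "0\<^sub>m n n \<le> X * R" and C: "0\<^sub>m n n \<le> X * U"
    and D_ge: "X + (X * R + X * U) * D \<le> D"
  shows "rspectral_radius (double_iteration_mat (X * R) (X * U)) < 1"
proof (rule ccontr)
  let ?r = "rspectral_radius (double_iteration_mat (X * R) (X * U))"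
  assume "\<not> ?r < 1"
  then have r1: "?r \<ge> 1" by simp
  from double_iteration_row[OF n B C refl] r1
  obtain y where y: "y \<in> carrier_mat 1 n" "0\<^sub>m 1 n \<le> y" "y \<noteq> 0\<^sub>m 1 n"
    and sub: "?r\<^sup>2 \<cdot>\<^sub>m y \<le> ?r \<cdot>\<^sub>m (y * (X * R)) + y * (X * U)" by auto
  have [simp]: "dim_row D = n" "dim_col D = m" "dim_row X = n" "dim_col X = m"
    "dim_row R = m" "dim_col R = n" "dim_row U = m" "dim_col U = n" "dim_row y = 1" "dim_col y = n"
    using mat_le_dim[OF D] mat_le_dim[OF X] RU y by auto
  \<comment> \<open>As \<open>r >= 1\<close>, both coefficients on the right of \<open>sub\<close>
    can be raised to \<open>r^2\<close>, which then cancels.\<close>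
  have le: "y \<le> y * (X * R) + y * (X * U)"
  proof (rule mat_leI)
    fix i j assume "i < dim_row (y * (X * R) + y * (X * U))" "j < dim_col (y * (X * R) + y * (X * U))"
    then have ij: "i < 1" "j < n" by auto
    let ?b = "(y * (X * R)) $$ (i,j)" and ?c = "(y * (X * U)) $$ (i,j)"
    have b: "0 \<le> ?b" "0 \<le> ?c"
      using mat_leD[OF mat_mult_nonneg[OF y(2) B], of i j] mat_leD[OF mat_mult_nonneg[OF y(2) C], of i j] ij
      by (simp_all del: index_mult_mat(1))
    have "?r\<^sup>2 * y $$ (i,j) \<le> ?r * ?b + ?c"
      using mat_leD[OF sub, of i j] ij by (simp del: index_mult_mat(1))
    also have "\<dots> \<le> ?r\<^sup>2 * ?b + ?r\<^sup>2 * ?c"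
    proof (rule add_mono)
      show "?r * ?b \<le> ?r\<^sup>2 * ?b" using r1 b by (intro mult_right_mono) (auto simp: power2_eq_square)
      show "?c \<le> ?r\<^sup>2 * ?c" using r1 b mult_right_mono[of 1 "?r\<^sup>2" ?c] by (simp only: mult_1 one_le_power)
    qed
    also have "\<dots> = ?r\<^sup>2 * (?b + ?c)" by (simp only: distrib_left)
    finally have "y $$ (i,j) \<le> ?b + ?c" using r1 by (subst (asm) mult_le_cancel_left_pos) auto
    then show "y $$ (i,j) \<le> (y * (X * R) + y * (X * U)) $$ (i,j)" using ij by (simp del: index_mult_mat(1))
  qed auto
  have yD: "y * D \<le> (y * (X * R) + y * (X * U)) * D"
    using D le by (intro mat_mult_right_mono[of _ m]) auto
  have yD': "y * (X + (X * R + X * U) * D) \<le> y * D"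
    using y(2) D_ge by (intro mat_mult_left_mono[of 1]) auto
  have yX0: "0\<^sub>m 1 m \<le> y * X" using mat_mult_nonneg[OF y(2) X] .
  \<comment> \<open>Chaining \<open>yD'\<close> and \<open>yD\<close> bounds
    \<open>y X + y (X R + X U) D\<close> by its second summand.\<close>
  have "y * X \<le> 0\<^sub>m 1 m"
  proof (rule mat_leI)
    fix i j assume "i < dim_row (0\<^sub>m 1 m :: real mat)" "j < dim_col (0\<^sub>m 1 m :: real mat)"
    then show "(y * X) $$ (i,j) \<le> 0\<^sub>m 1 m $$ (i,j)"
      using mat_leD[OF order_trans[OF yD' yD], of i j] by (simp add: mat_dim_simps del: index_mult_mat(1))
  qed auto
  with yX0 have yX: "y * X = 0\<^sub>m 1 m" by (rule antisym[rotated])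
  have "y * (X * R) = 0\<^sub>m 1 n" "y * (X * U) = 0\<^sub>m 1 n"
    using yX by (simp_all add: mult_assoc_dim[symmetric])
  with le have "y \<le> 0\<^sub>m 1 n" by simp
  with y show False by (metis antisym)
qed

text \<open>With \<open>U = - S2\<close>, \<open>B = X1 R1\<close> and \<open>C = - X1 S1\<close>,
  the blocks \<open>B'\<close> and \<open>C'\<close> are those of \<open>W_12\<close>, now with
  nonnegative factors only.\<close>

lemma double_iteration_comparison:
  fixes A D X1 X2 B C R U :: "real mat"
  defines "B' \<equiv> X2 * R + X2 * U * B" and "C' \<equiv> X2 * U * C"
  assumes m: "m > 0" and n: "n > 0"
    and A: "A \<in> carrier_mat m n" and D: "0\<^sub>m n m \<le> D" and X1: "0\<^sub>m n m \<le> X1" and X12: "X1 \<le> X2"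
    and B: "0\<^sub>m n n \<le> B" and C: "0\<^sub>m n n \<le> C" and R: "0\<^sub>m m n \<le> R" and U: "0\<^sub>m m n \<le> U"
    and D1: "D = X1 + (B + C) * D" and D2: "D = X2 + (X2 * R + X2 * U) * D"
    and AR: "A * D * R = R" and AU: "A * D * U = U" and BR: "B \<le> X2 * R"
  shows "rspectral_radius (double_iteration_mat B' C') \<le> rspectral_radius (double_iteration_mat B C)"
proof -
  define \<mu> where "\<mu> = rspectral_radius (double_iteration_mat B' C')"
  have X2: "0\<^sub>m n m \<le> X2" using X1 X12 by (rule order_trans)
  have [simp]: "dim_row A = m" "dim_col A = n" "dim_row D = n" "dim_col D = m" "dim_row X1 = n" "dim_col X1 = m"
    "dim_row X2 = n" "dim_col X2 = m" "dim_row B = n" "dim_col B = n" "dim_row C = n" "dim_col C = n"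
    "dim_row R = m" "dim_col R = n" "dim_row U = m" "dim_col U = n"
    using A mat_le_dim[OF D] mat_le_dim[OF X1] mat_le_dim[OF X2] mat_le_dim[OF B] mat_le_dim[OF C]
      mat_le_dim[OF R] mat_le_dim[OF U] by auto
  have BC_carr: "double_iteration_mat B C \<in> carrier_mat (n + n) (n + n)" by auto
  have UB: "0\<^sub>m m n \<le> U * B" and UC: "0\<^sub>m m n \<le> U * C"
    using mat_mult_nonneg[OF U B] mat_mult_nonneg[OF U C] by auto
  have RUB: "0\<^sub>m m n \<le> R + U * B"
    using mat_leD[OF R] mat_leD[OF UB] by (intro mat_leI) (auto simp del: index_mult_mat(1))
  have B'_eq: "B' = X2 * (R + U * B)" and C'_eq: "C' = X2 * (U * C)"
    by (simp_all add: B'_def C'_def mat_dim_simps)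
  have B': "0\<^sub>m n n \<le> B'" and C': "0\<^sub>m n n \<le> C'"
    unfolding B'_eq C'_eq by (rule mat_mult_nonneg[OF X2 RUB], rule mat_mult_nonneg[OF X2 UC])
  have [simp]: "dim_row B' = n" "dim_col B' = n" "dim_row C' = n" "dim_col C' = n"
    by (simp_all add: B'_def C'_def)

  \<comment> \<open>Expanding \<open>U D\<close> in \<open>D2\<close> by \<open>D1\<close> gives
    \<open>D = X2 + (B' + C') D + X2 U X1\<close>; the last term is nonnegative and is
    dropped.\<close>
  have "\<mu> < 1" unfolding \<mu>_def B'_eq C'_eq
  proof (rule double_iteration_lt_1[OF n D X2])
    have "D = X1 + (B * D + C * D)" using D1 by (simp add: add_mult_dim)
    from arg_cong[OF this, of "\<lambda>M. X2 * U * M"]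
    have e1: "X2 * (U * D) = X2 * (U * X1) + (X2 * (U * (B * D)) + X2 * (U * (C * D)))"
      by (simp add: mat_dim_simps)
    have e2: "D = X2 + (X2 * (R * D) + X2 * (U * D))" using D2 by (simp add: mat_dim_simps)
    have pos: "0\<^sub>m n m \<le> X2 * (U * X1)" by (intro mat_mult_nonneg[OF X2] mat_mult_nonneg[OF U X1])
    show "X2 + (X2 * (R + U * B) + X2 * (U * C)) * D \<le> D"
    proof (rule mat_leI)
      fix i j assume ij: "i < dim_row D" "j < dim_col D"
      then show "(X2 + (X2 * (R + U * B) + X2 * (U * C)) * D) $$ (i,j) \<le> D $$ (i,j)"
        using arg_cong[OF e1, of "\<lambda>M. M $$ (i,j)"] arg_cong[OF e2, of "\<lambda>M. M $$ (i,j)"] mat_leD[OF pos, of i j]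
        by (simp add: mat_dim_simps del: index_mult_mat(1))
    qed auto
  qed (use B' C' in \<open>auto simp: B'_eq C'_eq\<close>)
  show ?thesis
  proof (cases "\<mu> > 0")
    case False
    moreover have "0 \<le> rspectral_radius (double_iteration_mat B C)"
      using n by (intro rspectral_radius_nonneg[OF BC_carr]) auto
    ultimately show ?thesis by (simp add: \<mu>_def)
  next
    case True
    from double_iteration_row[OF n B' C' \<mu>_def True]
    obtain y where y: "y \<in> carrier_mat 1 n" "0\<^sub>m 1 n \<le> y" "y \<noteq> 0\<^sub>m 1 n"
      and sub: "\<mu>\<^sup>2 \<cdot>\<^sub>m y \<le> \<mu> \<cdot>\<^sub>m (y * B') + y * C'" by auto
    define z where "z = y * X2"
    have [simp]: "dim_row y = 1" "dim_col y = n" "dim_row z = 1" "dim_col z = m" using y by (auto simp: z_def)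
    have z0: "0\<^sub>m 1 m \<le> z" unfolding z_def by (rule mat_mult_nonneg[OF y(2) X2])
    have yB': "y * B' = z * (R + U * B)" and yC': "y * C' = z * (U * C)"
      by (simp_all add: B'_eq C'_eq z_def mult_assoc_dim)
    have "\<mu>\<^sup>2 \<le> \<mu>" using True \<open>\<mu> < 1\<close> by (simp add: power2_eq_square)
    have "\<mu>\<^sup>2 < 1" using True \<open>\<mu> < 1\<close> \<open>\<mu>\<^sup>2 \<le> \<mu>\<close> by simp
    \<comment> \<open>Replacing \<open>y D\<close> by \<open>z + z R D + z U D\<close> in the
      inequality for \<open>y\<close> and collecting the terms in \<open>z R D\<close> and
      \<open>z U D\<close> leaves these coefficients. The lower bound used for \<open>z U D\<close>
      is \<open>\<mu> z U B D + z U C D\<close>.\<close>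
    define J where "J = ((\<mu> - \<mu>\<^sup>2) \<cdot>\<^sub>m R + (1 - \<mu>\<^sup>2) \<cdot>\<^sub>m U) * D"
    have J: "J \<in> carrier_mat m m" by (auto simp: J_def)
    have [simp]: "dim_row J = m" "dim_col J = m" by (auto simp: J_def)
    have J0: "0\<^sub>m m m \<le> J" unfolding J_def
      using mat_leD[OF R] mat_leD[OF U] \<open>\<mu>\<^sup>2 \<le> \<mu>\<close> \<open>\<mu>\<^sup>2 < 1\<close>
      by (intro mat_mult_nonneg[OF _ D] mat_leI) auto
    have zJ_ge: "\<mu>\<^sup>2 \<cdot>\<^sub>m z \<le> z * J"
    proof (rule mat_leI)
      fix i j assume "i < dim_row (z * J)" "j < dim_col (z * J)"
      then have ij: "i < 1" "j < m" by auto
      have e1: "z * (U * D) = z * (U * X1) + (z * (U * (B * D)) + z * (U * (C * D)))"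
        using arg_cong[OF D1, of "\<lambda>M. z * (U * M)"] by (simp add: mat_dim_simps)
      have e2: "y * D = z + (z * (R * D) + z * (U * D))"
        using arg_cong[OF D2, of "\<lambda>M. y * M"] by (simp add: mat_dim_simps z_def)
      have "(\<mu>\<^sup>2 \<cdot>\<^sub>m y) * D \<le> (\<mu> \<cdot>\<^sub>m (y * B') + y * C') * D"
        using D sub by (intro mat_mult_right_mono[of _ m]) auto
      then have i1: "\<mu>\<^sup>2 \<cdot>\<^sub>m (y * D) \<le> \<mu> \<cdot>\<^sub>m (z * (R * D) + z * (U * (B * D))) + z * (U * (C * D))"
        by (simp add: yB' yC' mat_dim_simps)
      have p1: "0\<^sub>m 1 m \<le> z * (U * X1)" by (intro mat_mult_nonneg[OF z0] mat_mult_nonneg[OF U X1])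
      have p2: "0\<^sub>m 1 m \<le> z * (U * (B * D))"
        by (intro mat_mult_nonneg[OF z0] mat_mult_nonneg[OF U] mat_mult_nonneg[OF B D])
      have zJ: "z * J = (\<mu> - \<mu>\<^sup>2) \<cdot>\<^sub>m (z * (R * D)) + (1 - \<mu>\<^sup>2) \<cdot>\<^sub>m (z * (U * D))"
        by (simp add: J_def mat_dim_simps)
      define a b p q t where "a = (z * (R * D)) $$ (i,j)" and "b = (z * (U * D)) $$ (i,j)"
        and "p = (z * (U * (B * D))) $$ (i,j)" and "q = (z * (U * (C * D))) $$ (i,j)"
        and "t = (z * (U * X1)) $$ (i,j)"
      note ents = a_def b_def p_def q_def t_def
      have b: "b = t + (p + q)"
        using arg_cong[OF e1, of "\<lambda>M. M $$ (i,j)"] ij by (simp add: ents del: index_mult_mat(1))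
      have e: "(y * D) $$ (i,j) = z $$ (i,j) + (a + b)"
        using arg_cong[OF e2, of "\<lambda>M. M $$ (i,j)"] ij by (simp add: ents del: index_mult_mat(1))
      have "\<mu>\<^sup>2 * (y * D) $$ (i,j) \<le> \<mu> * (a + p) + q"
        using mat_leD[OF i1, of i j] ij by (simp add: ents del: index_mult_mat(1))
      moreover have "0 \<le> t" "0 \<le> p"
        using mat_leD[OF p1, of i j] mat_leD[OF p2, of i j] ij by (simp_all add: ents del: index_mult_mat(1))
      moreover from this have "0 \<le> (1 - \<mu>) * p" using \<open>\<mu> < 1\<close> by simp
      ultimately have "\<mu>\<^sup>2 * z $$ (i,j) \<le> (\<mu> - \<mu>\<^sup>2) * a + (1 - \<mu>\<^sup>2) * b"
        unfolding e using b by (simp add: algebra_simps)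
      then show "(\<mu>\<^sup>2 \<cdot>\<^sub>m z) $$ (i,j) \<le> (z * J) $$ (i,j)"
        unfolding zJ using ij by (simp add: ents del: index_mult_mat(1))
    qed auto
    have z_ne: "z \<noteq> 0\<^sub>m 1 m"
    proof
      assume z: "z = 0\<^sub>m 1 m"
      have "\<mu>\<^sup>2 \<cdot>\<^sub>m y \<le> 0\<^sub>m 1 n" using sub unfolding yB' yC' unfolding z by simp
      then have "y \<le> 0\<^sub>m 1 n" using True by (auto simp: less_eq_mat_def mult_le_0_iff)
      with y show False by (metis antisym)
    qed
    have "z \<in> carrier_mat 1 m" by (rule carrier_matI) auto
    from subinvariant_row_le_rspectral_radius[OF J J0 this z0 z_ne zJ_ge]
    have \<mu>J: "\<mu>\<^sup>2 \<le> rspectral_radius J" .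

    from subinvariant_col_exists[OF J m J0] obtain h0 where
      h0: "h0 \<in> carrier_mat m 1" "0\<^sub>m m 1 \<le> h0" "h0 \<noteq> 0\<^sub>m m 1" and Jh0: "rspectral_radius J \<cdot>\<^sub>m h0 \<le> J * h0" .
    \<comment> \<open>Passing from \<open>h0\<close> to \<open>J * h0\<close> keeps subinvariance
      and places the vector in the range of \<open>J\<close>. As \<open>A * D\<close> fixes that
      range, \<open>A * v = h\<close>, which keeps \<open>v\<close> nonzero.\<close>
    define h where "h = J * h0"
    have [simp]: "dim_row h0 = m" "dim_col h0 = 1" "dim_row h = m" "dim_col h = 1"
      using h0 by (auto simp: h_def)
    have "\<mu>\<^sup>2 \<cdot>\<^sub>m h0 \<le> rspectral_radius J \<cdot>\<^sub>m h0"
      using mat_leD[OF h0(2)] \<mu>J by (intro mat_leI) (auto intro: mult_right_mono)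
    then have \<mu>h0: "\<mu>\<^sup>2 \<cdot>\<^sub>m h0 \<le> h" using Jh0 unfolding h_def by (rule order_trans)
    have h: "0\<^sub>m m 1 \<le> h" unfolding h_def by (rule mat_mult_nonneg[OF J0 h0(2)])
    have "h \<noteq> 0\<^sub>m m 1"
    proof
      assume "h = 0\<^sub>m m 1"
      with \<mu>h0 have "h0 \<le> 0\<^sub>m m 1" using True by (auto simp: less_eq_mat_def mult_le_0_iff)
      with h0 show False by (metis antisym)
    qed
    have "J * (\<mu>\<^sup>2 \<cdot>\<^sub>m h0) \<le> J * h" using J0 \<mu>h0 by (intro mat_mult_left_mono[of m]) auto
    then have \<mu>h: "\<mu>\<^sup>2 \<cdot>\<^sub>m h \<le> J * h" by (simp add: h_def mult_smult_dim)
    define v where "v = D * h"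
    have [simp]: "dim_row v = n" "dim_col v = 1" by (auto simp: v_def)
    have v0: "0\<^sub>m n 1 \<le> v" unfolding v_def by (rule mat_mult_nonneg[OF D h])
    have "A * D * J = J"
      using AR AU by (simp add: J_def mat_dim_simps) (simp add: mult_assoc_dim[symmetric])
    then have Av: "A * v = h" by (simp add: v_def h_def mult_assoc_dim[symmetric])
    have v_ne: "v \<noteq> 0\<^sub>m n 1" using Av \<open>h \<noteq> 0\<^sub>m m 1\<close> by auto
    have v_ge: "\<mu>\<^sup>2 \<cdot>\<^sub>m v \<le> \<mu> \<cdot>\<^sub>m (B * v) + C * v"
    proof (rule mat_leI)
      fix i j assume "i < dim_row (\<mu> \<cdot>\<^sub>m (B * v) + C * v)" "j < dim_col (\<mu> \<cdot>\<^sub>m (B * v) + C * v)"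
      then have ij: "i < n" "j < 1" by auto
      have "X2 * (\<mu>\<^sup>2 \<cdot>\<^sub>m h) \<le> X2 * (J * h)" using X2 \<mu>h by (intro mat_mult_left_mono[of n]) auto
      then have i1: "\<mu>\<^sup>2 \<cdot>\<^sub>m (X2 * h) \<le> (\<mu> - \<mu>\<^sup>2) \<cdot>\<^sub>m (X2 * (R * v)) + (1 - \<mu>\<^sup>2) \<cdot>\<^sub>m (X2 * (U * v))"
        by (simp add: J_def v_def mat_dim_simps)
      have e1: "v = X1 * h + (B * v + C * v)"
        using arg_cong[OF D1, of "\<lambda>M. M * h"] by (simp add: v_def mat_dim_simps)
      have e2: "v = X2 * h + (X2 * (R * v) + X2 * (U * v))"
        using arg_cong[OF D2, of "\<lambda>M. M * h"] by (simp add: v_def mat_dim_simps)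
      have i2: "X1 * h \<le> X2 * h" using h X12 by (intro mat_mult_right_mono[of _ 1]) auto
      have "B * v \<le> (X2 * R) * v" using v0 BR by (intro mat_mult_right_mono[of _ 1]) auto
      then have i3: "B * v \<le> X2 * (R * v)" by (simp add: mult_assoc_dim)
      define f g b c b2 c2 where "f = (X2 * h) $$ (i,j)" and "g = (X1 * h) $$ (i,j)"
        and "b = (B * v) $$ (i,j)" and "c = (C * v) $$ (i,j)"
        and "b2 = (X2 * (R * v)) $$ (i,j)" and "c2 = (X2 * (U * v)) $$ (i,j)"
      note ents = f_def g_def b_def c_def
        b2_def c2_def
      have f: "\<mu>\<^sup>2 * f \<le> (\<mu> - \<mu>\<^sup>2) * b2 + (1 - \<mu>\<^sup>2) * c2"
        using mat_leD[OF i1, of i j] ij by (simp add: ents del: index_mult_mat(1))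
      have v1: "v $$ (i,j) = g + (b + c)"
        using arg_cong[OF e1, of "\<lambda>M. M $$ (i,j)"] ij by (simp add: ents del: index_mult_mat(1))
      have v2: "v $$ (i,j) = f + (b2 + c2)"
        using arg_cong[OF e2, of "\<lambda>M. M $$ (i,j)"] ij by (simp add: ents del: index_mult_mat(1))
      have gf: "g \<le> f" and bb: "b \<le> b2"
        using mat_leD[OF i2, of i j] mat_leD[OF i3, of i j] ij by (simp_all add: ents del: index_mult_mat(1))
      \<comment> \<open>From \<open>g <= f\<close> the two expansions of \<open>v\<close> give
        \<open>b2 + c2 <= b + c\<close>. Subtracting
        \<open>(1 - \<mu>) * b2 >= (1 - \<mu>) * b\<close> turns this into the bound by
        \<open>\<mu> * b + c\<close>.\<close>
      have "0 \<le> (1 - \<mu>) * (b2 - b)" using bb \<open>\<mu> < 1\<close> by simp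
      have "\<mu>\<^sup>2 * v $$ (i,j) \<le> \<mu> * b2 + c2" unfolding v2 using f by (simp add: algebra_simps)
      also have "\<dots> \<le> \<mu> * b + c" using \<open>0 \<le> (1 - \<mu>) * (b2 - b)\<close> gf v1 v2 by (simp add: algebra_simps)
      finally show "(\<mu>\<^sup>2 \<cdot>\<^sub>m v) $$ (i,j) \<le> (\<mu> \<cdot>\<^sub>m (B * v) + C * v) $$ (i,j)"
        using ij by (simp add: ents del: index_mult_mat(1))
    qed auto
    have "v \<in> carrier_mat n 1" by (rule carrier_matI) auto
    from double_iteration_col[OF B C _ this v0 v_ne v_ge] True
    show ?thesis unfolding \<mu>_def[symmetric] by simp
  qed
qed

section \<open>From proper splittings to the abstract comparison\<close>

lemma mp_inverse_splitting:
  fixes A P R S :: "real mat"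
  assumes A: "A \<in> carrier_mat m n" and spl: "double_proper_splitting A P R S"
  defines "X \<equiv> mp_inverse P" and "D \<equiv> mp_inverse A"
  shows "D = X + (X * R + X * - S) * D" "A * D = P * X"
proof -
  note spl = spl[unfolded double_proper_splitting_def]
  have d [simp]: "dim_row A = m" "dim_col A = n" "dim_row P = m" "dim_col P = n"
    "dim_row R = m" "dim_col R = n" "dim_row S = m" "dim_col S = n"
    "dim_row X = n" "dim_col X = m" "dim_row D = n" "dim_col D = m"
    using A spl by (auto simp: X_def D_def)
  show AD: "A * D = P * X" unfolding X_def D_def
    using range_proj_eq[of P A] spl by simp
  have XP: "X * P = D * A" unfolding X_def D_def using null_proj_eq[of P A] spl by simp
  \<comment> \<open>Expand \<open>D = X P D\<close> with \<open>P = A + R - S\<close>; the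
    \<open>A\<close> term contributes \<open>X A D = X P X = X\<close>.\<close>
  have "A = P - R + S" using spl by simp
  then have "P = A + (R + - S)"
    by (auto simp: mat_eq_iff)
  then have "X * P * D = X * (A + (R + - S)) * D" by simp
  moreover have "X * P * D = D" unfolding XP D_def by (rule mp_inverse_props)
  moreover have "X * (A * D) = X" unfolding AD
    using mp_inverse_props(2)[of P] by (simp add: X_def mult_assoc_dim)
  ultimately show "D = X + (X * R + X * - S) * D" by (simp add: mat_dim_simps del: uminus_mult_right_mat)
qed

theorem theorem3p8:
  fixes A P1 R1 S1 P2 R2 S2 :: "real mat" and m n :: nat
  assumes "m > 0" and "n > 0"
    and "A \<in> carrier_mat m n"
    and "semi_monotone A"
    and "double_proper_weak_regular A P1 R1 S1"
    and "double_proper_regular A P2 R2 S2"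
    and "mat_null S2 \<supseteq> mat_null P2"
    and "mat_range S2 \<subseteq> mat_range P2"
    and "1 \<notin> rspectrum (S2 * mp_inverse P1)"
    and "mp_inverse ((1\<^sub>m m - S2 * mp_inverse P1) * A) \<ge> 0\<^sub>m n m"
    and "mp_inverse P1 \<le> mp_inverse P2"
    and "mp_inverse P1 * R1 \<le> mp_inverse P2 * R2"
  shows "rspectral_radius
           (four_block_mat
              (mp_inverse P2 * R2 - mp_inverse P2 * S2 * mp_inverse P1 * R1)
              (mp_inverse P2 * S2 * mp_inverse P1 * S1)
              (1\<^sub>m n) (0\<^sub>m n n))
         \<le> rspectral_radius
           (four_block_mat (mp_inverse P1 * R1) (- (mp_inverse P1 * S1)) (1\<^sub>m n) (0\<^sub>m n n))
       \<and> rspectral_radius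
           (four_block_mat (mp_inverse P1 * R1) (- (mp_inverse P1 * S1)) (1\<^sub>m n) (0\<^sub>m n n)) < 1"
proof -
  note spl1 = assms(5)[unfolded double_proper_weak_regular_def]
    and spl2 = assms(6)[unfolded double_proper_regular_def]
  define D where "D = mp_inverse A"
  define X1 where "X1 = mp_inverse P1"
  define X2 where "X2 = mp_inverse P2"
  define U where "U = - S2"
  have d [simp]: "dim_row A = m" "dim_col A = n" "dim_row P1 = m" "dim_col P1 = n"
    "dim_row R1 = m" "dim_col R1 = n" "dim_row S1 = m" "dim_col S1 = n"
    "dim_row P2 = m" "dim_col P2 = n"
    "dim_row R2 = m" "dim_col R2 = n" "dim_row S2 = m" "dim_col S2 = n"
    using assms(3) spl1 spl2 by (auto simp: double_proper_splitting_def)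
  have d' [simp]: "dim_row X1 = n" "dim_col X1 = m" "dim_row X2 = n" "dim_col X2 = m"
    "dim_row D = n" "dim_col D = m" "dim_row U = m" "dim_col U = n"
    by (auto simp: X1_def X2_def D_def U_def)
  have D0: "0\<^sub>m n m \<le> D" using assms(4) by (simp add: semi_monotone_def D_def)
  have X10: "0\<^sub>m n m \<le> X1" and B0: "0\<^sub>m n n \<le> X1 * R1" and XS: "X1 * S1 \<le> 0\<^sub>m n n"
    using spl1 by (simp_all add: X1_def)
  have C0: "0\<^sub>m n n \<le> X1 * - S1"
    using XS by (auto simp: less_eq_mat_def simp del: index_mult_mat(1))
  have R0: "0\<^sub>m m n \<le> R2" using spl2 by simp
  have U0: "0\<^sub>m m n \<le> U" using spl2 by (auto simp: U_def less_eq_mat_def)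
  have D1: "D = X1 + (X1 * R1 + X1 * - S1) * D"
    unfolding D_def X1_def using mp_inverse_splitting(1)[OF assms(3)] spl1 by blast
  have D2: "D = X2 + (X2 * R2 + X2 * U) * D" and AD: "A * D = P2 * X2"
    unfolding D_def X2_def U_def using mp_inverse_splitting[OF assms(3)] spl2 by blast+
  \<comment> \<open>\<open>A * D\<close> projects onto the common range of \<open>A\<close> and
    \<open>P2\<close>, which contains that of \<open>S2\<close>. It therefore also fixes
    \<open>R2 = P2 - A + S2\<close>.\<close>
  have PS: "A * D * S2 = S2"
    unfolding AD X2_def by (rule range_proj_fixes) (use assms(8) in auto)
  then have AU: "A * D * U = U" by (simp add: U_def)
  have PP: "A * D * P2 = P2" unfolding AD X2_def by (rule mp_inverse_props)
  have PA: "A * D * A = A" unfolding D_def by (rule mp_inverse_props)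
  have "A = P2 - R2 + S2" using spl2 by (simp add: double_proper_splitting_def)
  then have R2: "R2 = P2 - A + S2" by (auto simp: mat_eq_iff)
  have "A * D * (P2 - A + S2) = A * D * P2 - A * D * A + A * D * S2"
    by (simp add: mult_add_dim mult_minus_dim)
  then have AR: "A * D * R2 = R2" unfolding PP PA PS R2[symmetric] .
  have T: "rspectral_radius (double_iteration_mat (X1 * R1) (X1 * - S1)) < 1"
    by (rule double_iteration_lt_1[OF \<open>n > 0\<close> D0 X10 _ _ B0 C0])
      (use D1 in \<open>auto simp del: uminus_mult_right_mat\<close>)
  have le: "rspectral_radius (double_iteration_mat (X2 * R2 + X2 * U * (X1 * R1)) (X2 * U * (X1 * - S1)))
    \<le> rspectral_radius (double_iteration_mat (X1 * R1) (X1 * - S1))"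
    by (rule double_iteration_comparison[OF assms(1,2,3) D0 X10 _ B0 C0 R0 U0 D1 D2 AR AU])
      (use assms in \<open>auto simp: X1_def X2_def\<close>)
  \<comment> \<open>Return to the signs of the statement; in the second block the two negations
    cancel.\<close>
  have "X2 * R2 + X2 * U * (X1 * R1) = X2 * R2 - X2 * S2 * X1 * R1"
    by (intro eq_matI) (simp_all add: U_def mult_assoc_dim del: index_mult_mat(1))
  moreover have "X2 * U * (X1 * - S1) = X2 * S2 * X1 * S1"
    by (simp add: U_def mult_assoc_dim)
  ultimately show ?thesis using T le by (simp add: X1_def X2_def)
qed

end
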